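(* Suppose $r$ is a positive integer and $c\in\mathbb Z$ with $c\neq 0$. Let $b(n)$ be a polynomial in $n$ with integral coefficients and the property $b(-1-n)=(-1)^rb(n)$ for any $n\in\mathbb Z$. Define the sequence $\{u_n\}_{n\ge 0}$ of rational numbers by $$u_0=1,\quad u_1=b(0)\quad\text{and}\quad (n+1)^ru_{n+1}=b(n)u_n-cn^ru_{n-1}\quad (n\ge 1).$$ Let $p$ be an odd prime. Suppose that $u_m\in\mathbb Z_p$ for $m=0,1,2,\ldots$ and that $k$ is a positive integer. Then $$u_{kp+n}\equiv u_{kp}u_n\pmod p\quad\text{for } n=0,1,\ldots,p-1.$$
   Context: $\mathbb Z_p$ denotes the set of rational numbers whose denominator is not divisible by $p$; congruences modulo $p$ are taken in this ring. *)

theory Defs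
  imports
    Complex_Main
    "HOL-Computational_Algebra.Primes"
    "HOL-Computational_Algebra.Polynomial"
begin

(* quotient_of gives the fraction in lowest terms with positive denominator. *)
definition Zp :: "nat \<Rightarrow> rat set" where
  "Zp p = {x. \<not> int p dvd snd (quotient_of x)}"

(* Both sides are required to lie in Zp p: the congruence is one in that ring,
   modulo its principal ideal generated by p. *)
definition cong_Zp :: "nat \<Rightarrow> rat \<Rightarrow> rat \<Rightarrow> bool" where
  "cong_Zp p x y \<longleftrightarrow> x \<in> Zp p \<and> y \<in> Zp p \<and> (\<exists>z\<in>Zp p. x - y = of_nat p * z)"

end

theory Submission
  imports Defs "HOL-Number_Theory.Cong"
begin

text \<open>
  Reducing the recurrence at index \<open>k p + n\<close> modulo \<open>p\<close> gives the recurrence at index \<open>n\<close>;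
  at \<open>n = 0\<close> the last term vanishes because \<open>r > 0\<close>, so the sequence \<open>u (k p + n)\<close> starts
  afresh with initial value \<open>u (k p)\<close>. The leading coefficient \<open>(n + 1)^r\<close> is a unit modulo
  \<open>p\<close> as long as \<open>n + 1 < p\<close>.
\<close>

text \<open>The reduced denominator divides the denominator of any other representation, so any
  fraction with denominator prime to \<open>p\<close> witnesses membership. Closure properties can
  then be read off from unreduced sums and products.\<close>

lemma Zp_iff:
  assumes "prime p"
  shows "x \<in> Zp p \<longleftrightarrow> (\<exists>a d. \<not> int p dvd d \<and> x = of_int a / of_int d)"
proof
  assume x: "x \<in> Zp p"
  obtain a d where ad: "quotient_of x = (a, d)"
    by fastforce
  then show "\<exists>a d. \<not> int p dvd d \<and> x = of_int a / of_int d"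
    using x quotient_of_div[OF ad] by (auto simp: Zp_def)
next
  assume "\<exists>a d. \<not> int p dvd d \<and> x = of_int a / of_int d"
  then obtain a d where d: "\<not> int p dvd d" and x: "x = of_int a / of_int d"
    by blast
  obtain a' d' where ad': "quotient_of x = (a', d')"
    by fastforce
  have "d \<noteq> 0" "d' > 0" "x = of_int a' / of_int d'"
    using d quotient_of_denom_pos[OF ad'] quotient_of_div[OF ad'] by auto
  then have "of_int (a * d') = (of_int (a' * d) :: rat)"
    using x by (simp add: field_simps)
  then have "d' dvd a' * d"
    by (metis dvd_triv_right of_int_eq_iff)
  then have "d' dvd d"
    using quotient_of_coprime[OF ad'] by (simp add: coprime_commute coprime_dvd_mult_right_iff)
  then show "x \<in> Zp p"
    using d ad' by (auto simp: Zp_def intro: dvd_trans)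
qed

lemma Zp_of_int:
  assumes "prime p"
  shows "of_int a \<in> Zp p"
proof -
  have "\<not> int p dvd 1"
    using assms by (simp add: prime_nat_iff)
  then show ?thesis
    unfolding Zp_iff[OF assms] by (intro exI[of _ a] exI[of _ 1]) simp
qed

lemma Zp_mult:
  assumes p: "prime p" and "x \<in> Zp p" "y \<in> Zp p"
  shows "x * y \<in> Zp p"
proof -
  obtain a d a' d' where *: "\<not> int p dvd d" "\<not> int p dvd d'"
    "x = of_int a / of_int d" "y = of_int a' / of_int d'"
    using assms by (auto simp: Zp_iff[OF p])
  have "\<not> int p dvd d * d'"
    using p * by (simp add: prime_dvd_mult_iff)
  then show ?thesis
    unfolding Zp_iff[OF p] by (intro exI[of _ "a * a'"] exI[of _ "d * d'"]) (simp add: *)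
qed

lemma Zp_diff:
  assumes p: "prime p" and "x \<in> Zp p" "y \<in> Zp p"
  shows "x - y \<in> Zp p"
proof -
  obtain a d a' d' where *: "\<not> int p dvd d" "\<not> int p dvd d'"
    "x = of_int a / of_int d" "y = of_int a' / of_int d'"
    using assms by (auto simp: Zp_iff[OF p])
  have "\<not> int p dvd d * d'"
    using p * by (simp add: prime_dvd_mult_iff)
  moreover have "d \<noteq> 0" "d' \<noteq> 0"
    using * by auto
  ultimately show ?thesis
    unfolding Zp_iff[OF p]
    by (intro exI[of _ "a * d' - a' * d"] exI[of _ "d * d'"]) (simp add: * field_simps)
qed

lemma Zp_add:
  assumes "prime p" "x \<in> Zp p" "y \<in> Zp p"
  shows "x + y \<in> Zp p"
  using Zp_diff[OF assms(1,2) Zp_diff[OF assms(1) Zp_of_int[OF assms(1), of 0] assms(3)]] by simp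

lemma Zp_divide_int:
  assumes p: "prime p" and "x \<in> Zp p" "\<not> int p dvd m"
  shows "x / of_int m \<in> Zp p"
proof -
  obtain a d where *: "\<not> int p dvd d" "x = of_int a / of_int d"
    using assms by (auto simp: Zp_iff[OF p])
  have "\<not> int p dvd d * m"
    using p * assms(3) by (simp add: prime_dvd_mult_iff)
  then show ?thesis
    unfolding Zp_iff[OF p] by (intro exI[of _ a] exI[of _ "d * m"]) (simp add: *)
qed

lemma cong_Zp_refl:
  assumes "prime p" "x \<in> Zp p"
  shows "cong_Zp p x x"
  unfolding cong_Zp_def using assms Zp_of_int[of p 0] by (auto intro!: bexI[of _ 0])

lemma cong_Zp_of_int:
  assumes "prime p" "[a = d] (mod int p)"
  shows "cong_Zp p (of_int a) (of_int d)"
proof -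
  obtain z where "a - d = int p * z"
    using assms(2) by (auto simp: cong_iff_dvd_diff)
  then have "of_int a - of_int d = (of_nat p :: rat) * of_int z"
    by (metis of_int_diff of_int_mult of_int_of_nat_eq)
  then show ?thesis
    unfolding cong_Zp_def using Zp_of_int[OF assms(1)] by blast
qed

lemma cong_Zp_trans:
  assumes "prime p" "cong_Zp p x y" "cong_Zp p y z"
  shows "cong_Zp p x z"
proof -
  obtain s t where "s \<in> Zp p" "x - y = of_nat p * s" "t \<in> Zp p" "y - z = of_nat p * t"
    using assms by (auto simp: cong_Zp_def)
  then have "x - z = of_nat p * (s + t)" "s + t \<in> Zp p"
    by (auto simp: algebra_simps Zp_add assms(1))
  then show ?thesis
    using assms unfolding cong_Zp_def by blast
qed

lemma cong_Zp_diff: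
  assumes "prime p" "cong_Zp p x y" "cong_Zp p x' y'"
  shows "cong_Zp p (x - x') (y - y')"
proof -
  obtain s t where "s \<in> Zp p" "x - y = of_nat p * s" "t \<in> Zp p" "x' - y' = of_nat p * t"
    using assms by (auto simp: cong_Zp_def)
  then have "x - x' - (y - y') = of_nat p * (s - t)" "s - t \<in> Zp p"
    by (auto simp: algebra_simps Zp_diff assms(1))
  then show ?thesis
    using assms Zp_diff[OF assms(1)] unfolding cong_Zp_def by blast
qed

lemma cong_Zp_mult:
  assumes "prime p" "cong_Zp p x y" "cong_Zp p x' y'"
  shows "cong_Zp p (x * x') (y * y')"
proof -
  obtain s t where st: "s \<in> Zp p" "x - y = of_nat p * s" "t \<in> Zp p" "x' - y' = of_nat p * t"
    using assms by (auto simp: cong_Zp_def)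
  \<comment> \<open>The cofactors \<open>x'\<close> and \<open>y\<close> lie in \<open>Zp p\<close>
    because \<open>cong_Zp\<close> includes membership of both sides.\<close>
  have "x * x' - y * y' = (x - y) * x' + y * (x' - y')"
    by (simp add: algebra_simps)
  also have "\<dots> = of_nat p * (s * x' + y * t)"
    by (simp add: st algebra_simps)
  finally have "x * x' - y * y' = of_nat p * (s * x' + y * t)" .
  moreover have "s * x' + y * t \<in> Zp p"
    using assms st by (auto simp: cong_Zp_def intro!: Zp_add Zp_mult)
  ultimately show ?thesis
    using assms Zp_mult[OF assms(1)] unfolding cong_Zp_def by blast
qed

text \<open>An integer prime to \<open>p\<close> is a unit of \<open>Zp p\<close>, so the quotient
  \<open>z / of_int m\<close> stays in the ring.\<close>

lemma cong_Zp_cancel_int: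
  assumes "prime p" "\<not> int p dvd m" "x \<in> Zp p" "y \<in> Zp p"
    and "cong_Zp p (of_int m * x) (of_int m * y)"
  shows "cong_Zp p x y"
proof -
  obtain z where z: "z \<in> Zp p" "of_int m * x - of_int m * y = of_nat p * z"
    using assms by (auto simp: cong_Zp_def)
  have "m \<noteq> 0"
    using assms(2) by auto
  then have "x - y = of_nat p * (z / of_int m)"
    using z(2) by (simp add: field_simps)
  then show ?thesis
    using assms Zp_divide_int[OF assms(1) z(1) assms(2)] unfolding cong_Zp_def by blast
qed

text \<open>Integral coefficients make the value of \<open>b\<close> depend only on the residue of
  its argument, so \<open>b\<close> does not see the shift by \<open>k * p\<close>.\<close>

lemma cong_poly:
  fixes f :: "int poly"
  assumes "[x = y] (mod m)"
  shows "[poly f x = poly f y] (mod m)"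
  by (induction f) (auto intro!: cong_add cong_mult assms)

theorem theorem3p2:
  fixes r :: nat and c :: int and b :: "int poly" and u :: "nat \<Rightarrow> rat"
    and p k :: nat
  assumes "r > 0" and "c \<noteq> 0"
    and "\<And>n :: int. poly b (- 1 - n) = (- 1) ^ r * poly b n"
    and "u 0 = 1" and "u 1 = of_int (poly b 0)"
    and "\<And>n :: nat. n \<ge> 1 \<Longrightarrow>
      of_nat (n + 1) ^ r * u (n + 1) =
        of_int (poly b (int n)) * u n - of_int c * of_nat n ^ r * u (n - 1)"
    and "prime p" and "odd p"
    and "\<And>m :: nat. u m \<in> Zp p"
    and "k > 0"
  shows "\<forall>n \<in> {0..p - 1}. cong_Zp p (u (k * p + n)) (u (k * p) * u n)"
proof -
  note p = \<open>prime p\<close>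
  note Zp_u = \<open>\<And>m. u m \<in> Zp p\<close>
  \<comment> \<open>For \<open>n = 0\<close> the term \<open>u (n - 1)\<close> is the junk value \<open>u 0\<close>, but its coefficient vanishes.\<close>
  have rec: "of_int (int (n + 1) ^ r) * u (n + 1) =
      of_int (poly b (int n)) * u n - of_int c * (of_int (int n ^ r) * u (n - 1))" for n
  proof (cases "n = 0")
    case True
    then show ?thesis
      using assms(1,4,5) by (simp add: zero_power)
  next
    case False
    then show ?thesis
      using assms(6)[of n] by (simp add: algebra_simps)
  qed
  have shift: "[int (k * p + m) = int m] (mod int p)" for m
    by (simp add: cong_def)
  have "cong_Zp p (u (k * p + n)) (u (k * p) * u n)" if "n < p" for n
    using that
  \<comment> \<open>Strong induction, since the recurrence for index \<open>n\<close> reaches back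
    to both \<open>n - 1\<close> and \<open>n - 2\<close>.\<close>
  proof (induction n rule: less_induct)
    case (less n)
    show ?case
    proof (cases n)
      case 0
      then show ?thesis
        using cong_Zp_refl[OF p Zp_u] assms(4) by simp
    next
      case (Suc m)
      let ?N = "k * p + m" and ?v = "u (k * p)"
      \<comment> \<open>Trades the coefficient of the recurrence at \<open>m\<close> for the one at
        \<open>?N\<close>, so that \<open>rec\<close> at \<open>?N\<close> applies to the right-hand
        side.\<close>
      have lead: "cong_Zp p (of_int (int (m + 1) ^ r) * u (?N + 1))
          (of_int (int (?N + 1) ^ r) * u (?N + 1))"
        using shift[of "m + 1"]
        by (intro cong_Zp_mult p cong_Zp_of_int cong_Zp_refl Zp_u cong_pow)
          (simp add: cong_sym add.assoc)
      have prev: "cong_Zp p (of_int (int ?N ^ r) * u (?N - 1)) (of_int (int m ^ r) * (?v * u (m - 1)))"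
      proof (cases "m = 0")
        case True
        \<comment> \<open>Here \<open>?N - 1\<close> is \<open>k * p - 1\<close>, an index that the
          induction hypothesis does not reach. Its value is immaterial: the coefficient is congruent
          to \<open>0 ^ r = 0\<close>, and the target is 0 for the same reason.\<close>
        have prev: "cong_Zp p (of_int (int ?N ^ r) * u (?N - 1)) (of_int (int m ^ r) * u (?N - 1))"
          by (intro cong_Zp_mult p cong_Zp_of_int cong_Zp_refl Zp_u cong_pow shift)
        then show ?thesis
          using True \<open>r > 0\<close> by (simp add: zero_power)
      next
        case False
        then have "cong_Zp p (u (?N - 1)) (?v * u (m - 1))"
          using less.IH[of "m - 1"] less.prems Suc by simp
        then show ?thesis
          by (intro cong_Zp_mult p cong_Zp_of_int cong_pow shift)
      qed
      have "cong_Zp p (u ?N) (?v * u m)"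
        using less Suc by simp
      then have "cong_Zp p (of_int (int (?N + 1) ^ r) * u (?N + 1))
          (of_int (poly b (int m)) * (?v * u m) -
            of_int c * (of_int (int m ^ r) * (?v * u (m - 1))))"
        unfolding rec[of ?N]
        by (intro cong_Zp_diff[OF p] cong_Zp_mult[OF p _ prev] cong_Zp_mult[OF p]
            cong_Zp_of_int[OF p] cong_poly shift cong_refl)
      \<comment> \<open>The recurrence is linear, so \<open>?v\<close> factors out and
        \<open>rec\<close> at \<open>m\<close> folds the remaining terms back into
        \<open>u (m + 1)\<close>.\<close>
      also have "of_int (poly b (int m)) * (?v * u m) -
          of_int c * (of_int (int m ^ r) * (?v * u (m - 1))) =
          ?v * (of_int (int (m + 1) ^ r) * u (m + 1))"
        unfolding rec[of m] by (simp add: algebra_simps)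
      also have "\<dots> = of_int (int (m + 1) ^ r) * (?v * u (m + 1))"
        by (simp only: mult.left_commute)
      finally have "cong_Zp p (of_int (int (m + 1) ^ r) * u (?N + 1))
          (of_int (int (m + 1) ^ r) * (?v * u (m + 1)))"
        using cong_Zp_trans[OF p lead] by blast
      moreover have "\<not> int p dvd int (m + 1) ^ r"
      proof
        assume "int p dvd int (m + 1) ^ r"
        then have "p dvd m + 1"
          using p prime_dvd_power by (metis int_dvd_int_iff of_nat_power)
        then show False
          using less.prems Suc by (auto dest: dvd_imp_le)
      qed
      ultimately have "cong_Zp p (u (?N + 1)) (?v * u (m + 1))"
        using cong_Zp_cancel_int p Zp_u Zp_mult by blast
      then show ?thesis
        using Suc by simp
    qed
  qed
  \<comment> \<open>Subtraction on naturals is truncated, so this needs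
    \<open>p > 0\<close>.\<close>
  moreover have "n < p" if "n \<in> {0..p - 1}" for n
    using that prime_gt_0_nat[OF p] by auto
  ultimately show ?thesis
    by blast
qed

end
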